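(* Let $\mathcal{I}$ be a nonempty collection of subsets of $\{1,\ldots,n\}$ with $\emptyset\notin\mathcal{I}$, let $\hat c\in\mathbb{R}^n$ with $\hat c\ge 0$, let $d\in\mathbb{R}^n$ with $d>0$ (componentwise), and let $\Gamma\ge 1$ be an integer. Let $\mathcal{Z}$, $\mathcal{Z}_\eta$, $\mathbb{H}$, $\mathcal{I}_\eta$ and $\mathrm{HittingSetNum}$ be as defined in the context. Suppose there exists an optimal solution $I^{\mathrm{RO}}$ of the robust optimization problem $\min_{I\in\mathcal{I}}\max_{z\in\mathcal{Z}}\sum_{j\in I}(\hat c_j+d_jz_j)$ for which $\max_{z\in\mathcal{Z}}\sum_{j\in I^{\mathrm{RO}}}(\hat c_j+d_jz_j)$ has a unique optimal solution. If $\eta\in\mathbb{H}$ and $\mathrm{HittingSetNum}(\mathcal{I}_\eta)>\Gamma$, then $$\min_{I\in\mathcal{I}}\max_{z\in\mathcal{Z}_\eta}\sum_{j\in I}(\hat c_j+d_jz_j)<\min_{I\in\mathcal{I}}\max_{z\in\mathcal{Z}}\sum_{j\in I}(\hat c_j+d_jz_j).$$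
   Context: Definitions: the budget uncertainty set is $\mathcal{Z}:=\{z\in[0,1]^n:\sum_{j=1}^nz_j\le\Gamma\}$. For $\eta\in\mathbb{R}$ the reduced uncertainty set is $\mathcal{Z}_\eta:=\{z\in\mathcal{Z}:\min_{I\in\mathcal{I}}\sum_{j\in I}(\hat c_j+d_jz_j)\ge\eta\}$. The half-open interval $$\mathbb{H}:=\Big(\min_{I\in\mathcal{I}}\sum_{j\in I}\hat c_j,\ \max_{z\in\mathcal{Z}}\min_{I\in\mathcal{I}}\sum_{j\in I}(\hat c_j+d_jz_j)\Big].$$ The collection of near-optimal solutions is $\mathcal{I}_\eta:=\{I\in\mathcal{I}:\eta-\sum_{j\in I}\hat c_j>0\}$. The hitting set number is $$\mathrm{HittingSetNum}(\mathcal{I}_\eta):=\min_{z\in\{0,1\}^n}\Big\{\sum_{j=1}^nz_j:\ \sum_{j\in I}z_j\ge 1\ \text{for all }I\in\mathcal{I}_\eta\Big\},$$ i.e. the minimum cardinality of a subset of $\{1,\ldots,n\}$ intersecting every element of $\mathcal{I}_\eta$. *)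

theory Defs
  imports "HOL-Analysis.Analysis"
begin

text \<open>
  The ground set of \<open>n\<close> items is the index type \<open>'n\<close>, so that \<open>n = CARD('n)\<close>.
  Maxima over uncertainty sets are written as suprema: each of these sets is compact and
  the objectives are continuous, so the suprema are attained whenever the set is nonempty
  (see the lemmas at the end).
\<close>

definition cost :: "real^'n \<Rightarrow> real^'n \<Rightarrow> real^'n \<Rightarrow> 'n set \<Rightarrow> real" where
  "cost c d z I = (\<Sum>j\<in>I. c $ j + d $ j * z $ j)"

definition budget_set :: "nat \<Rightarrow> (real^'n) set" where
  "budget_set \<Gamma> = {z. (\<forall>j. 0 \<le> z $ j \<and> z $ j \<le> 1) \<and> (\<Sum>j\<in>UNIV. z $ j) \<le> real \<Gamma>}"

definition min_cost :: "'n set set \<Rightarrow> real^'n \<Rightarrow> real^'n \<Rightarrow> real^'n \<Rightarrow> real" where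
  "min_cost \<I> c d z = Min ((\<lambda>I. cost c d z I) ` \<I>)"

definition reduced_set ::
    "'n set set \<Rightarrow> real^'n \<Rightarrow> real^'n \<Rightarrow> nat \<Rightarrow> real \<Rightarrow> (real^'n) set" where
  "reduced_set \<I> c d \<Gamma> \<eta> = {z \<in> budget_set \<Gamma>. min_cost \<I> c d z \<ge> \<eta>}"

definition worst_case :: "real^'n \<Rightarrow> real^'n \<Rightarrow> (real^'n) set \<Rightarrow> 'n set \<Rightarrow> real" where
  "worst_case c d Z I = (SUP z\<in>Z. cost c d z I)"

definition robust_value ::
    "'n set set \<Rightarrow> real^'n \<Rightarrow> real^'n \<Rightarrow> (real^'n) set \<Rightarrow> real" where
  "robust_value \<I> c d Z = Min ((\<lambda>I. worst_case c d Z I) ` \<I>)"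

definition eta_interval ::
    "'n set set \<Rightarrow> real^'n \<Rightarrow> real^'n \<Rightarrow> nat \<Rightarrow> real set" where
  "eta_interval \<I> c d \<Gamma> =
     {Min ((\<lambda>I. \<Sum>j\<in>I. c $ j) ` \<I>) <.. (SUP z\<in>budget_set \<Gamma>. min_cost \<I> c d z)}"

definition near_optimal :: "'n set set \<Rightarrow> real^'n \<Rightarrow> real \<Rightarrow> 'n set set" where
  "near_optimal \<I> c \<eta> = {I \<in> \<I>. \<eta> - (\<Sum>j\<in>I. c $ j) > 0}"

text \<open>
  Below, the set under \<open>Min\<close> is always finite; it is nonempty exactly when the empty set is not
  a member of \<open>\<J>\<close>. The value for \<open>\<J> = {}\<close> is \<open>0\<close>.
\<close>

definition hitting_set_num :: "('n::finite) set set \<Rightarrow> nat" where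
  "hitting_set_num \<J> =
     Min {\<Sum>j\<in>UNIV. z $ j | z :: nat^'n.
            (\<forall>j. z $ j \<in> {0, 1}) \<and> (\<forall>I\<in>\<J>. (\<Sum>j\<in>I. z $ j) \<ge> 1)}"

lemma continuous_on_cost: "continuous_on S (\<lambda>z. cost c d z I)"
  unfolding cost_def by (intro continuous_intros)

lemma continuous_on_min_cost:
  fixes \<I> :: "('n::finite) set set"
  assumes "\<I> \<noteq> {}"
  shows "continuous_on S (min_cost \<I> c d)"
proof -
  have "finite \<I>" by simp
  then have "continuous_on S (\<lambda>z. Min ((\<lambda>I. cost c d z I) ` \<I>))"
    using assms
  proof (induction rule: finite_ne_induct)
    case (insert I F)
    then show ?case
      by (simp add: continuous_on_min continuous_on_cost)
  qed (simp add: continuous_on_cost)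
  then show ?thesis
    by (simp add: min_cost_def[abs_def])
qed

lemma compact_budget_set: "compact (budget_set \<Gamma> :: (real^'n) set)"
proof -
  have "budget_set \<Gamma> = cbox 0 1 \<inter> {z :: real^'n. (\<Sum>j\<in>UNIV. z $ j) \<le> real \<Gamma>}"
    by (auto simp: budget_set_def mem_box_cart)
  moreover have "closed {z :: real^'n. (\<Sum>j\<in>UNIV. z $ j) \<le> real \<Gamma>}"
    by (intro closed_Collect_le continuous_intros)
  ultimately show ?thesis
    by (simp add: compact_Int_closed)
qed

lemma compact_reduced_set:
  assumes "\<I> \<noteq> {}"
  shows "compact (reduced_set \<I> c d \<Gamma> \<eta>)"
proof -
  have "reduced_set \<I> c d \<Gamma> \<eta> = budget_set \<Gamma> \<inter> {z. \<eta> \<le> min_cost \<I> c d z}"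
    by (auto simp: reduced_set_def)
  moreover have "closed {z. \<eta> \<le> min_cost \<I> c d z}"
    by (intro closed_Collect_le continuous_on_min_cost continuous_intros assms)
  ultimately show ?thesis
    by (simp add: compact_Int_closed compact_budget_set)
qed

lemma budget_set_nonempty: "budget_set \<Gamma> \<noteq> {}"
proof -
  have "0 \<in> budget_set \<Gamma>" by (simp add: budget_set_def)
  then show ?thesis by blast
qed

lemma SUP_attained_compact:
  fixes f :: "'a::topological_space \<Rightarrow> real"
  assumes "compact S" "S \<noteq> {}" "continuous_on S f"
  shows "\<exists>x\<in>S. f x = (SUP y\<in>S. f y) \<and> (\<forall>y\<in>S. f y \<le> f x)"
proof -
  obtain x where x: "x \<in> S" "\<forall>y\<in>S. f y \<le> f x"
    using continuous_attains_sup[OF assms] by blast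
  then have "(SUP y\<in>S. f y) = f x"
    by (intro cSup_eq_maximum) auto
  with x show ?thesis by auto
qed

lemma reduced_set_nonempty:
  assumes "\<I> \<noteq> {}" "\<eta> \<in> eta_interval \<I> c d \<Gamma>"
  shows "reduced_set \<I> c d \<Gamma> \<eta> \<noteq> {}"
proof -
  obtain x where "x \<in> budget_set \<Gamma>"
    "min_cost \<I> c d x = (SUP z\<in>budget_set \<Gamma>. min_cost \<I> c d z)"
    using SUP_attained_compact[OF compact_budget_set budget_set_nonempty
        continuous_on_min_cost[OF assms(1)]] by blast
  then have "x \<in> reduced_set \<I> c d \<Gamma> \<eta>"
    using assms(2) by (simp add: reduced_set_def eta_interval_def)
  then show ?thesis by blast
qed

end

theory Submission
  imports Defs
begin

text \<open>
  A maximizer of a linear objective over the budget set with more than \<open>\<Gamma>\<close> nonzero entries has two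
  fractional entries; shifting mass between them in both directions yields feasible points of which
  one is at least as good, so a unique maximizer \<open>z\<close> has at most \<open>\<Gamma>\<close> nonzero entries. By the
  assumption on the hitting set number its support misses some \<open>I \<in> \<I>\<^sub>\<eta>\<close>. That solution
  has cost below \<open>\<eta>\<close> under \<open>z\<close>, so \<open>z\<close> is cut off in the reduced set, and every remaining point is
  strictly worse for the robust optimum.
\<close>

lemma cost_add_scaled:
  "cost c d (z + t *\<^sub>R v) I = cost c d z I + t * (\<Sum>j\<in>I. d $ j * v $ j)"
  by (simp add: cost_def sum.distrib algebra_simps sum_distrib_left)

text \<open>Counting: if at most one of the more than \<open>\<Gamma>\<close> nonzero entries were
  below 1, the entries equal to 1 together with this positive one would exceed the budget.\<close>

lemma two_fractional_entries:
  fixes z :: "real^'n"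
  assumes z: "z \<in> budget_set \<Gamma>" and large: "card {j. z $ j \<noteq> 0} > \<Gamma>"
  obtains k l where "k \<noteq> l" "0 < z $ k" "z $ k < 1" "0 < z $ l" "z $ l < 1"
proof -
  let ?S = "{j. z $ j \<noteq> 0}"
  have bounds: "0 \<le> z $ j" "z $ j \<le> 1" for j
    using z by (auto simp: budget_set_def)
  have total: "(\<Sum>j\<in>?S. z $ j) \<le> real \<Gamma>"
  proof -
    have "(\<Sum>j\<in>?S. z $ j) = (\<Sum>j\<in>UNIV. z $ j)"
      by (rule sum.mono_neutral_left) auto
    then show ?thesis
      using z by (simp add: budget_set_def)
  qed
  have "\<exists>k\<in>?S. z $ k < 1"
  proof (rule ccontr)
    assume "\<not> ?thesis"
    then have "(\<Sum>j\<in>?S. z $ j) \<ge> (\<Sum>j\<in>?S. 1)"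
      by (intro sum_mono) (auto simp: not_less)
    then show False
      using total large by simp
  qed
  then obtain k where k: "k \<in> ?S" "z $ k < 1" by blast
  have "\<exists>l\<in>?S - {k}. z $ l < 1"
  proof (rule ccontr)
    assume "\<not> ?thesis"
    then have "(\<Sum>j\<in>?S - {k}. z $ j) \<ge> (\<Sum>j\<in>?S - {k}. 1)"
      by (intro sum_mono) (auto simp: not_less)
    then have "(\<Sum>j\<in>?S - {k}. z $ j) \<ge> real (card (?S - {k}))"
      by (simp only: sum_constant mult_1_right)
    moreover have "(\<Sum>j\<in>?S. z $ j) = z $ k + (\<Sum>j\<in>?S - {k}. z $ j)"
      using k by (simp add: sum.remove)
    \<comment> \<open>Integrality of \<open>\<Gamma>\<close> enters here: more than
      \<open>\<Gamma>\<close> elements means at least \<open>\<Gamma> + 1\<close>, so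
      \<open>\<Gamma>\<close> remain without \<open>k\<close>.\<close>
    moreover have "real (card (?S - {k})) \<ge> real \<Gamma>"
      using k(1) large by simp
    moreover have "z $ k > 0"
      using k(1) bounds(1)[of k] by simp
    ultimately show False
      using total by linarith
  qed
  then obtain l where l: "l \<in> ?S - {k}" "z $ l < 1" by blast
  have "0 < z $ k" "0 < z $ l"
    using k(1) l(1) bounds(1)[of k] bounds(1)[of l] by simp_all
  with k(2) l show ?thesis
    using that[of k l] by blast
qed

text \<open>The direction has coordinate sum 0, so the budget is untouched and only the box
  constraints at \<open>k\<close> and \<open>l\<close> matter. The bounds involve only the absolute
  value of \<open>t\<close>, so both signs are covered.\<close>

lemma budget_set_shift:
  fixes z :: "real^'n"
  assumes "z \<in> budget_set \<Gamma>" "k \<noteq> l"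
    and "\<bar>t\<bar> \<le> z $ k" "\<bar>t\<bar> \<le> 1 - z $ k" "\<bar>t\<bar> \<le> z $ l" "\<bar>t\<bar> \<le> 1 - z $ l"
  shows "z + t *\<^sub>R (axis k 1 - axis l 1) \<in> budget_set \<Gamma>"
proof -
  have "(\<Sum>j\<in>UNIV. (axis k 1 :: real^'n) $ j) = 1" for k
    by (simp add: axis_def)
  then have "(\<Sum>j\<in>UNIV. (z + t *\<^sub>R (axis k 1 - axis l 1)) $ j) = (\<Sum>j\<in>UNIV. z $ j)"
    by (simp only: vector_add_component vector_scaleR_component vector_minus_component sum.distrib
        sum_subtractf real_scaleR_def flip: sum_distrib_left) simp
  moreover have "0 \<le> (z + t *\<^sub>R (axis k 1 - axis l 1)) $ j \<and>
      (z + t *\<^sub>R (axis k 1 - axis l 1)) $ j \<le> 1" for j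
  proof -
    have "0 \<le> z $ j" "z $ j \<le> 1"
      using assms(1) by (auto simp: budget_set_def)
    then show ?thesis
      using assms(2-) by (auto simp: axis_def)
  qed
  ultimately show ?thesis
    using assms(1) unfolding budget_set_def by (simp only: mem_Collect_eq) simp
qed

lemma card_support_unique_maximizer_le:
  fixes z :: "real^'n"
  assumes z: "z \<in> budget_set \<Gamma>"
    and unique: "\<And>w. w \<in> budget_set \<Gamma> \<Longrightarrow> w \<noteq> z \<Longrightarrow> cost c d w I < cost c d z I"
  shows "card {j. z $ j \<noteq> 0} \<le> \<Gamma>"
proof (rule ccontr)
  assume "\<not> ?thesis"
  then obtain k l where kl: "k \<noteq> l" "0 < z $ k" "z $ k < 1" "0 < z $ l" "z $ l < 1"
    using two_fractional_entries[OF z] by (auto simp: not_le)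
  \<comment> \<open>The largest step that keeps entries \<open>k\<close> and \<open>l\<close> in
    [0,1] in both directions.\<close>
  define t where "t = Min {z $ k, 1 - z $ k, z $ l, 1 - z $ l}"
  define v :: "real^'n" where "v = axis k 1 - axis l 1"
  have t: "t > 0" "t \<le> z $ k" "t \<le> 1 - z $ k" "t \<le> z $ l" "t \<le> 1 - z $ l"
    using kl by (auto simp: t_def)
  have "v $ k = 1"
    using kl(1) by (simp add: v_def axis_def)
  then have "v \<noteq> 0" by auto
  have strict: "s * (\<Sum>j\<in>I. d $ j * v $ j) < 0" if "\<bar>s\<bar> = t" for s
  proof -
    have "z + s *\<^sub>R v \<in> budget_set \<Gamma>"
      unfolding v_def using that t by (intro budget_set_shift z kl(1)) auto
    moreover have "z + s *\<^sub>R v \<noteq> z"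
      using that t(1) \<open>v \<noteq> 0\<close> by auto
    ultimately have "cost c d (z + s *\<^sub>R v) I < cost c d z I"
      by (rule unique)
    then show ?thesis
      by (simp add: cost_add_scaled)
  qed
  \<comment> \<open>The cost is affine in \<open>z\<close>, so opposite steps change it by opposite
    amounts; both cannot be negative.\<close>
  from strict[of t] strict[of "- t"] t(1) show False
    by simp
qed

text \<open>The indicator vector of \<open>S\<close> is feasible for the minimization and has value
  \<open>card S\<close>.\<close>

lemma hitting_set_num_le_card:
  fixes S :: "'n::finite set"
  assumes "\<And>I. I \<in> \<J> \<Longrightarrow> I \<inter> S \<noteq> {}"
  shows "hitting_set_num \<J> \<le> card S"
proof -
  let ?V = "{\<Sum>j\<in>UNIV. z $ j | z :: nat^'n.
      (\<forall>j. z $ j \<in> {0, 1}) \<and> (\<forall>I\<in>\<J>. (\<Sum>j\<in>I. z $ j) \<ge> 1)}"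
  let ?z = "(\<chi> j. if j \<in> S then 1 else 0) :: nat^'n"
  have "?V \<subseteq> {..CARD('n)}"
  proof clarsimp
    fix z :: "nat^'n"
    assume "\<forall>j. z $ j = 0 \<or> z $ j = Suc 0"
    then have "z $ j = 0 \<or> z $ j = 1" for j
      by simp
    then have "z $ j \<le> 1" for j
      by (metis le_numeral_extra(4) zero_le_one)
    then show "(\<Sum>j\<in>UNIV. z $ j) \<le> CARD('n)"
      using sum_bounded_above[of UNIV "\<lambda>j. z $ j" 1] by simp
  qed
  then have "finite ?V"
    by (rule finite_subset) simp
  moreover have "card S \<in> ?V"
  proof -
    \<comment> \<open>Used twice: for members of \<open>\<J>\<close> it gives feasibility, for
      \<open>UNIV\<close> the objective value.\<close>
    have sum: "(\<Sum>j\<in>I. ?z $ j) = card (I \<inter> S)" for I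
      by (simp add: sum.If_cases)
    have "(\<Sum>j\<in>I. ?z $ j) \<ge> 1" if "I \<in> \<J>" for I
      unfolding sum using assms[OF that] by (simp add: Suc_le_eq card_gt_0_iff)
    moreover have "\<forall>j. ?z $ j \<in> {0, 1}"
      by simp
    moreover have "card S = (\<Sum>j\<in>UNIV. ?z $ j)"
      unfolding sum by simp
    ultimately show ?thesis
      by blast
  qed
  ultimately show ?thesis
    unfolding hitting_set_num_def by (rule Min_le)
qed

lemma small_support_notin_reduced_set:
  fixes z :: "real^'n"
  assumes "card {j. z $ j \<noteq> 0} < hitting_set_num (near_optimal \<I> c \<eta>)"
  shows "z \<notin> reduced_set \<I> c d \<Gamma> \<eta>"
proof -
  \<comment> \<open>The support is too small to be a hitting set. On a missed \<open>I\<close> all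
    deviations vanish, leaving the nominal cost.\<close>
  obtain I where I: "I \<in> near_optimal \<I> c \<eta>" "I \<inter> {j. z $ j \<noteq> 0} = {}"
    using assms hitting_set_num_le_card[of "near_optimal \<I> c \<eta>" "{j. z $ j \<noteq> 0}"]
    by (auto simp: not_le[symmetric])
  have "min_cost \<I> c d z \<le> cost c d z I"
    using I(1) by (auto simp: min_cost_def near_optimal_def)
  also have "\<dots> = (\<Sum>j\<in>I. c $ j)"
    unfolding cost_def using I(2) by (intro sum.cong) auto
  also have "\<dots> < \<eta>"
    using I(1) by (simp add: near_optimal_def)
  finally show ?thesis
    by (simp add: reduced_set_def)
qed

theorem proposition5:
  fixes \<I> :: "('n::finite) set set"
    and c d :: "real^'n"
    and \<Gamma> :: nat
    and \<eta> :: real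
  assumes "\<I> \<noteq> {}"
    and "{} \<notin> \<I>"
    and "\<And>j. c $ j \<ge> 0"
    and "\<And>j. d $ j > 0"
    and "\<Gamma> \<ge> 1"
    and "\<exists>I. is_arg_min (worst_case c d (budget_set \<Gamma>)) (\<lambda>J. J \<in> \<I>) I \<and>
             (\<exists>!z. is_arg_max (\<lambda>z. cost c d z I) (\<lambda>z. z \<in> budget_set \<Gamma>) z)"
    and "\<eta> \<in> eta_interval \<I> c d \<Gamma>"
    and "hitting_set_num (near_optimal \<I> c \<eta>) > \<Gamma>"
  shows "robust_value \<I> c d (reduced_set \<I> c d \<Gamma> \<eta>)
       < robust_value \<I> c d (budget_set \<Gamma>)"
proof -
  obtain I z where I: "is_arg_min (worst_case c d (budget_set \<Gamma>)) (\<lambda>J. J \<in> \<I>) I"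
    and z: "is_arg_max (\<lambda>z. cost c d z I) (\<lambda>z. z \<in> budget_set \<Gamma>) z"
    and uniq: "\<And>w. is_arg_max (\<lambda>z. cost c d z I) (\<lambda>z. z \<in> budget_set \<Gamma>) w \<Longrightarrow> w = z"
    using assms(6) by blast
  have "I \<in> \<I>" and I_min: "\<And>J. J \<in> \<I> \<Longrightarrow>
      worst_case c d (budget_set \<Gamma>) I \<le> worst_case c d (budget_set \<Gamma>) J"
    using I by (auto simp: is_arg_min_linorder)
  have zB: "z \<in> budget_set \<Gamma>" and z_max: "\<And>w. w \<in> budget_set \<Gamma> \<Longrightarrow> cost c d w I \<le> cost c d z I"
    using z by (auto simp: is_arg_max_linorder)
  have strict: "cost c d w I < cost c d z I" if "w \<in> budget_set \<Gamma>" "w \<noteq> z" for w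
  proof (rule ccontr)
    assume "\<not> ?thesis"
    then have "is_arg_max (\<lambda>z. cost c d z I) (\<lambda>z. z \<in> budget_set \<Gamma>) w"
      using that(1) z_max by (force simp: is_arg_max_linorder)
    then show False
      using uniq that(2) by blast
  qed
  have "card {j. z $ j \<noteq> 0} \<le> \<Gamma>"
    using zB strict by (rule card_support_unique_maximizer_le)
  then have z_cut: "z \<notin> reduced_set \<I> c d \<Gamma> \<eta>"
    using assms(8) by (intro small_support_notin_reduced_set) simp
  \<comment> \<open>Attainment of the supremum keeps the pointwise strict inequality strict; the
    upper end of the interval for \<open>\<eta>\<close> makes the reduced set nonempty.\<close>
  obtain w where w: "w \<in> reduced_set \<I> c d \<Gamma> \<eta>"
    "cost c d w I = worst_case c d (reduced_set \<I> c d \<Gamma> \<eta>) I"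
    using SUP_attained_compact[OF compact_reduced_set[OF assms(1)]
        reduced_set_nonempty[OF assms(1,7)] continuous_on_cost]
    unfolding worst_case_def by blast
  \<comment> \<open>\<open>I\<close> need only be a candidate for the reduced problem; its
    optimality is used for the full one.\<close>
  have "robust_value \<I> c d (reduced_set \<I> c d \<Gamma> \<eta>) \<le> cost c d w I"
    unfolding w(2) robust_value_def using \<open>I \<in> \<I>\<close> by (intro Min_le) auto
  also have "\<dots> < cost c d z I"
    using w(1) z_cut by (intro strict) (auto simp: reduced_set_def)
  also have "\<dots> = worst_case c d (budget_set \<Gamma>) I"
    unfolding worst_case_def using zB z_max by (intro cSup_eq_maximum[symmetric]) auto
  also have "\<dots> = robust_value \<I> c d (budget_set \<Gamma>)"
    unfolding robust_value_def using \<open>I \<in> \<I>\<close> I_min by (intro Min_eqI[symmetric]) auto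
  finally show ?thesis .
qed

end
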